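(* Let $Q=(Q_0,Q_1)$ be a connected acyclic quiver such that the canonical weight $\delta_Q$ is generic and $(Q,\delta_Q)$ is tight. Then $Z(\chi_{\delta_Q})=Z^{\mathrm{Cox}}(\Sigma_{\delta_Q})$.
   Context: Quiver: finite directed multigraph, arrow $a$ has tail $a^-$, head $a^+$. $\mathrm{inc}:\mathbb{R}^{Q_1}\to\mathbb{R}^{Q_0}$, $\mathrm{inc}(f)_i=\sum_{a^+=i}f(a)-\sum_{a^-=i}f(a)$; $\delta_Q=\mathrm{inc}(\mathbf{1})$. Subquiver $Q'$: same vertices, arrow subset $Q'_1$; $V\subseteq Q_0$ is $Q'$-successor closed if no arrow of $Q'_1$ goes from $V$ to its complement; $Q'$ is $\theta$-stable (resp. semistable) if $\sum_{i\in V}\theta(i)>0$ (resp. $\ge0$) for every nonempty proper $Q'$-successor closed $V$, $\theta$-unstable otherwise. $\theta$ generic: every $\theta$-semistable subquiver is $\theta$-stable. $(Q,\theta)$ tight: for each $a\in Q_1$ the subquiver with arrows $Q_1\setminus\{a\}$ is $\theta$-stable. $Z(\chi_\theta)=\{w\in\mathbb{C}^{Q_1}:\text{the subquiver with arrow set }\{a:w_a\ne0\}\text{ is }\theta\text{-unstable}\}$. $\Sigma_\theta$ is the normal fan (in $\ker(\mathrm{inc})^*$) of the flow polytope $P(Q,\theta)=\{x\in\mathbb{R}^{Q_1}:x\ge0,\mathrm{inc}(x)=\theta\}$; under tightness its rays are exactly the distinct rays $\rho_a=\mathbb{R}_{\ge0}\mathrm{ev}_a$, $a\in Q_1$, with $\mathrm{ev}_a(x)=x_a$.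 With coordinates $x_a$ on $\mathbb{C}^{Q_1}$, $Z^{\mathrm{Cox}}(\Sigma_\theta)$ is the common zero set of the monomials $\prod_{a:\rho_a\notin\sigma}x_a$ over all maximal cones $\sigma$ of $\Sigma_\theta$. *)

theory Defs
  imports
    "HOL-Analysis.Analysis"
    "Graph_Theory.Digraph_Component"
begin

text \<open>
  A quiver is a finite multidigraph \<open>Q\<close> from \<^theory>\<open>Graph_Theory.Digraph\<close>. The arrows live in a
  finite type \<open>'e\<close> of which \<^term>\<open>arcs Q\<close> may be any subset, possibly empty. The coordinate space
  on \<^term>\<open>arcs Q\<close> is the space of vectors indexed by \<open>'e\<close> that vanish off \<^term>\<open>arcs Q\<close>; it is
  used with real and with complex entries.
\<close>

definition arrow_space :: "('v, 'e::finite) pre_digraph \<Rightarrow> ('k::zero ^ 'e) set" where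
  "arrow_space Q = {x. \<forall>a. a \<notin> arcs Q \<longrightarrow> x $ a = 0}"

definition inc :: "('v, 'e::finite) pre_digraph \<Rightarrow> real ^ 'e \<Rightarrow> 'v \<Rightarrow> real" where
  "inc Q f i = (\<Sum>a | a \<in> arcs Q \<and> head Q a = i. f $ a) - (\<Sum>a | a \<in> arcs Q \<and> tail Q a = i. f $ a)"

definition ker_inc :: "('v, 'e::finite) pre_digraph \<Rightarrow> (real ^ 'e) set" where
  "ker_inc Q = {x \<in> arrow_space Q. \<forall>i \<in> verts Q. inc Q x i = 0}"

definition canonical_weight :: "('v, 'e::finite) pre_digraph \<Rightarrow> 'v \<Rightarrow> real" where
  "canonical_weight Q = inc Q (\<chi> a. indicat_real (arcs Q) a)"


text \<open>
  Stability is a property of a quiver on its own. Subquivers share the vertex set of \<open>Q\<close>, so they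
  are the spanning subgraphs; the one with arrow set \<open>A\<close> is \<^term>\<open>Q\<lparr>arcs := A\<rparr>\<close>.
\<close>

definition successor_closed :: "('v, 'e) pre_digraph \<Rightarrow> 'v set \<Rightarrow> bool" where
  "successor_closed Q V \<longleftrightarrow> V \<subseteq> verts Q \<and> (\<forall>a \<in> arcs Q. tail Q a \<in> V \<longrightarrow> head Q a \<in> V)"

definition stable :: "('v \<Rightarrow> real) \<Rightarrow> ('v, 'e) pre_digraph \<Rightarrow> bool" where
  "stable \<theta> Q \<longleftrightarrow>
    (\<forall>V. V \<noteq> {} \<and> V \<subset> verts Q \<and> successor_closed Q V \<longrightarrow> (\<Sum>i\<in>V. \<theta> i) > 0)"

definition semistable :: "('v \<Rightarrow> real) \<Rightarrow> ('v, 'e) pre_digraph \<Rightarrow> bool" where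
  "semistable \<theta> Q \<longleftrightarrow>
    (\<forall>V. V \<noteq> {} \<and> V \<subset> verts Q \<and> successor_closed Q V \<longrightarrow> (\<Sum>i\<in>V. \<theta> i) \<ge> 0)"

definition unstable :: "('v \<Rightarrow> real) \<Rightarrow> ('v, 'e) pre_digraph \<Rightarrow> bool" where
  "unstable \<theta> Q \<longleftrightarrow> \<not> semistable \<theta> Q"

definition generic :: "('v, 'e) pre_digraph \<Rightarrow> ('v \<Rightarrow> real) \<Rightarrow> bool" where
  "generic Q \<theta> \<longleftrightarrow> (\<forall>Q'. spanning Q' Q \<longrightarrow> semistable \<theta> Q' \<longrightarrow> stable \<theta> Q')"

definition tight :: "('v, 'e) pre_digraph \<Rightarrow> ('v \<Rightarrow> real) \<Rightarrow> bool" where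
  "tight Q \<theta> \<longleftrightarrow> (\<forall>a \<in> arcs Q. stable \<theta> (Q\<lparr>arcs := arcs Q - {a}\<rparr>))"

definition Z_chi :: "('v, 'e::finite) pre_digraph \<Rightarrow> ('v \<Rightarrow> real) \<Rightarrow> (complex ^ 'e) set" where
  "Z_chi Q \<theta> = {w \<in> arrow_space Q. unstable \<theta> (Q\<lparr>arcs := {a \<in> arcs Q. w $ a \<noteq> 0}\<rparr>)}"


definition flow_polytope :: "('v, 'e::finite) pre_digraph \<Rightarrow> ('v \<Rightarrow> real) \<Rightarrow> (real ^ 'e) set" where
  "flow_polytope Q \<theta> =
    {x \<in> arrow_space Q. (\<forall>a \<in> arcs Q. x $ a \<ge> 0) \<and> (\<forall>i \<in> verts Q. inc Q x i = \<theta> i)}"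

text \<open>
  The algebraic dual of a subspace \<open>K\<close>: linear functionals on \<open>K\<close>, normalised to be
  \<^const>\<open>undefined\<close> outside \<open>K\<close> so that equal functionals are equal functions.
\<close>

definition dual_space :: "'b::real_vector set \<Rightarrow> ('b \<Rightarrow> real) set" where
  "dual_space K = {\<phi> \<in> extensional K.
    (\<forall>x\<in>K. \<forall>y\<in>K. \<phi> (x + y) = \<phi> x + \<phi> y) \<and> (\<forall>c. \<forall>x\<in>K. \<phi> (c *\<^sub>R x) = c * \<phi> x)}"

text \<open>
  The normal cone of a face \<open>F\<close> of \<open>P\<close> consists of the functionals on \<open>K\<close> that attain their minimum
  over \<open>P\<close> on all of \<open>F\<close> (inner normals). Since \<open>P\<close> only lies in a translate of \<open>K\<close>, this is
  expressed by the differences \<open>y - x\<close>, which do lie in \<open>K\<close>.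
\<close>

definition normal_cone :: "'b::real_vector set \<Rightarrow> 'b set \<Rightarrow> 'b set \<Rightarrow> ('b \<Rightarrow> real) set" where
  "normal_cone K P F = {\<phi> \<in> dual_space K. \<forall>x\<in>F. \<forall>y\<in>P. \<phi> (y - x) \<ge> 0}"

definition normal_fan :: "'b::real_vector set \<Rightarrow> 'b set \<Rightarrow> ('b \<Rightarrow> real) set set" where
  "normal_fan K P = {normal_cone K P F | F. F face_of P \<and> F \<noteq> {}}"

definition flow_fan ::
    "('v, 'e::finite) pre_digraph \<Rightarrow> ('v \<Rightarrow> real) \<Rightarrow> (real ^ 'e \<Rightarrow> real) set set" where
  "flow_fan Q \<theta> = normal_fan (ker_inc Q) (flow_polytope Q \<theta>)"

definition maximal_cones :: "'c set set \<Rightarrow> 'c set set" where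
  "maximal_cones \<Sigma> = {\<sigma> \<in> \<Sigma>. \<forall>\<tau> \<in> \<Sigma>. \<sigma> \<subseteq> \<tau> \<longrightarrow> \<tau> = \<sigma>}"

definition ev :: "('v, 'e::finite) pre_digraph \<Rightarrow> 'e \<Rightarrow> real ^ 'e \<Rightarrow> real" where
  "ev Q a = restrict (\<lambda>x. x $ a) (ker_inc Q)"

definition ray :: "('v, 'e::finite) pre_digraph \<Rightarrow> 'e \<Rightarrow> (real ^ 'e \<Rightarrow> real) set" where
  "ray Q a = {restrict (\<lambda>x. c * ev Q a x) (ker_inc Q) | c. c \<ge> 0}"

text \<open>
  A ray of a fan belongs to a cone \<open>\<sigma>\<close> of the fan (that is, it is one of the rays generating \<open>\<sigma>\<close>) iff
  it is contained in \<open>\<sigma>\<close> as a set.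
\<close>

definition Z_Cox ::
    "('v, 'e::finite) pre_digraph \<Rightarrow> (real ^ 'e \<Rightarrow> real) set set \<Rightarrow> (complex ^ 'e) set" where
  "Z_Cox Q \<Sigma> = {w \<in> arrow_space Q.
    \<forall>\<sigma> \<in> maximal_cones \<Sigma>. (\<Prod>a | a \<in> arcs Q \<and> \<not> ray Q a \<subseteq> \<sigma>. w $ a) = 0}"

end

theory Submission
  imports Defs
begin

text \<open>
  The all-ones vector is a flow, so a subquiver with arrow set \<open>A\<close> is semistable iff some point of
  the flow polytope \<open>P\<close> is supported in \<open>A\<close>: among all flows take one with least total value
  outside \<open>A\<close>; if that value is positive, either the flow can be rerouted or the vertices reachable
  in the residual quiver form a destabilising successor closed set. Tightness then says that every
  coordinate has minimum \<open>0\<close> on \<open>P\<close>, so the rays in the normal cone of a face are those of the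
  coordinates vanishing on it. Hence \<open>w\<close> lies outside either locus iff some vertex of \<open>P\<close> is
  supported in the support of \<open>w\<close>.
\<close>

section \<open>The incidence map and net inflow into vertex sets\<close>

text \<open>Double counting: a vertex of \<open>V\<close> sees \<open>f $ a\<close> with sign plus
  at its head and minus at its tail. Arrows inside \<open>V\<close> cancel and only those crossing
  its boundary remain, so sums of a weight over \<open>V\<close> become net inflows.\<close>

lemma sum_inc:
  fixes Q :: "('v, 'e::finite) pre_digraph"
  assumes "finite V"
  shows "(\<Sum>i\<in>V. inc Q f i) =
    (\<Sum>a\<in>arcs Q. (of_bool (head Q a \<in> V) - of_bool (tail Q a \<in> V)) * f $ a)"
proof -
  have fibres: "(\<Sum>i\<in>V. \<Sum>a | a \<in> arcs Q \<and> h a = i. f $ a) =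
      (\<Sum>a\<in>arcs Q. of_bool (h a \<in> V) * f $ a)" for h :: "'e \<Rightarrow> 'v"
  proof -
    have "(\<Sum>i\<in>V. \<Sum>a | a \<in> arcs Q \<and> h a = i. f $ a) =
        (\<Sum>i\<in>V. \<Sum>a\<in>arcs Q. if h a = i then f $ a else 0)"
      by (intro sum.cong refl sum.inter_filter) simp
    also have "\<dots> = (\<Sum>a\<in>arcs Q. \<Sum>i\<in>V. if h a = i then f $ a else 0)"
      by (rule sum.swap)
    also have "\<dots> = (\<Sum>a\<in>arcs Q. of_bool (h a \<in> V) * f $ a)"
      using assms by (intro sum.cong refl) (simp add: sum.delta)
    finally show ?thesis .
  qed
  show ?thesis
    unfolding inc_def by (simp add: sum_subtractf fibres left_diff_distrib)
qed

lemma inc_add: "inc Q (f + g) i = inc Q f i + inc Q g i"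
  by (simp add: inc_def sum.distrib)

lemma inc_scaleR: "inc Q (c *\<^sub>R f) i = c * inc Q f i"
  by (simp add: inc_def sum_distrib_left right_diff_distrib)

lemma inc_diff: "inc Q (f - g) i = inc Q f i - inc Q g i"
  by (simp add: inc_def sum_subtractf)

lemma axis_nth: "axis a x $ b = (if b = a then x else 0)"
  by (simp add: axis_def)

lemma inc_axis:
  fixes Q :: "('v, 'e::finite) pre_digraph"
  assumes "a \<in> arcs Q"
  shows "inc Q (axis a 1) i = of_bool (head Q a = i) - of_bool (tail Q a = i)"
proof -
  have "(\<Sum>b | b \<in> arcs Q \<and> h b = i. axis a 1 $ b) = (of_bool (h a = i) :: real)" for h :: "'e \<Rightarrow> 'v"
    using assms by (simp add: axis_nth sum.delta)
  from this[of "head Q"] this[of "tail Q"] show ?thesis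
    by (simp only: inc_def)
qed

section \<open>Convexity and compactness of the flow polytope\<close>

lemma flow_polytopeD:
  assumes "x \<in> flow_polytope Q \<theta>"
  shows "x $ a \<ge> 0" "a \<notin> arcs Q \<Longrightarrow> x $ a = 0" "i \<in> verts Q \<Longrightarrow> inc Q x i = \<theta> i"
  using assms unfolding flow_polytope_def arrow_space_def
  by (cases "a \<in> arcs Q"; auto)+

lemma flow_polytopeI:
  assumes "\<And>a. x $ a \<ge> 0" "\<And>a. a \<notin> arcs Q \<Longrightarrow> x $ a = 0" "\<And>i. i \<in> verts Q \<Longrightarrow> inc Q x i = \<theta> i"
  shows "x \<in> flow_polytope Q \<theta>"
  using assms unfolding flow_polytope_def arrow_space_def by auto

lemma flow_polytope_diff_in_ker_inc:
  assumes "x \<in> flow_polytope Q \<theta>" "y \<in> flow_polytope Q \<theta>"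
  shows "y - x \<in> ker_inc Q"
  using flow_polytopeD[OF assms(1)] flow_polytopeD[OF assms(2)]
  by (auto simp: ker_inc_def arrow_space_def inc_diff)

lemma closed_flow_polytope: "closed (flow_polytope Q \<theta>)"
proof -
  have "flow_polytope Q \<theta> = (\<Inter>a. {x. x $ a \<ge> 0}) \<inter> (\<Inter>a\<in>- arcs Q. {x. x $ a = 0})
      \<inter> (\<Inter>i\<in>verts Q. {x. inc Q x i = \<theta> i})"
    using flow_polytopeD by (auto intro: flow_polytopeI)
  moreover have "closed {x. inc Q x i = \<theta> i}" for i
    unfolding inc_def by (intro closed_Collect_eq continuous_intros)
  ultimately show ?thesis
    by (simp add: closed_Int closed_INT closed_Collect_eq closed_Collect_le continuous_on_component)
qed

lemma convex_flow_polytope: "convex (flow_polytope Q \<theta>)"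
proof (rule convexI)
  fix x y and u v :: real
  assume *: "x \<in> flow_polytope Q \<theta>" "y \<in> flow_polytope Q \<theta>" "0 \<le> u" "0 \<le> v" "u + v = 1"
  show "u *\<^sub>R x + v *\<^sub>R y \<in> flow_polytope Q \<theta>"
    using * flow_polytopeD[OF *(1)] flow_polytopeD[OF *(2)]
    by (intro flow_polytopeI) (auto simp: inc_add inc_scaleR simp flip: distrib_right)
qed

text \<open>An arrow enters the set of vertices reachable from its head, which bounds its flow.\<close>

lemma bounded_flow_polytope:
  fixes Q :: "('v, 'e::finite) pre_digraph"
  assumes "fin_digraph Q" "acyclic (arcs_ends Q)"
  shows "bounded (flow_polytope Q \<theta>)"
proof -
  interpret fin_digraph Q by fact
  have bound: "\<bar>x $ a\<bar> \<le> (\<Sum>i\<in>verts Q. \<bar>\<theta> i\<bar>)" if x: "x \<in> flow_polytope Q \<theta>" for x a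
  proof (cases "a \<in> arcs Q")
    case False
    then show ?thesis
      using flow_polytopeD(2)[OF x] by (simp add: sum_nonneg)
  next
    case True
    define V where "V = {v \<in> verts Q. (head Q a, v) \<in> (arcs_ends Q)\<^sup>*}"
    have V: "finite V" "V \<subseteq> verts Q" "head Q a \<in> V"
      using True by (auto simp: V_def)
    have closed: "head Q b \<in> V" if "b \<in> arcs Q" "tail Q b \<in> V" for b
      using that by (auto simp: V_def arcs_ends_def arc_to_ends_def intro: rtrancl_into_rtrancl)
    have "(tail Q a, head Q a) \<in> arcs_ends Q"
      using True by (auto simp: arcs_ends_def arc_to_ends_def)
    \<comment> \<open>A path from the head of \<open>a\<close> back to its tail would close a
      cycle.\<close>
    then have "tail Q a \<notin> V"
      using assms(2) unfolding V_def acyclic_def by (auto dest: rtrancl_into_trancl2)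
    then have "x $ a \<le> (of_bool (head Q a \<in> V) - of_bool (tail Q a \<in> V)) * x $ a"
      using V by simp
    also have "\<dots> \<le> (\<Sum>b\<in>arcs Q. (of_bool (head Q b \<in> V) - of_bool (tail Q b \<in> V)) * x $ b)"
      using True closed flow_polytopeD(1)[OF x]
      by (intro member_le_sum) (auto simp: of_bool_def)
    also have "\<dots> = (\<Sum>i\<in>V. inc Q x i)"
      by (rule sum_inc[symmetric]) fact
    also have "\<dots> \<le> (\<Sum>i\<in>V. \<bar>\<theta> i\<bar>)"
      using V flow_polytopeD(3)[OF x] by (intro sum_mono) auto
    also have "\<dots> \<le> (\<Sum>i\<in>verts Q. \<bar>\<theta> i\<bar>)"
      using V by (intro sum_mono2) auto
    finally show ?thesis
      using flow_polytopeD(1)[OF x] by simp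
  qed
  have "norm x \<le> (\<Sum>a\<in>(UNIV::'e set). \<Sum>i\<in>verts Q. \<bar>\<theta> i\<bar>)" if "x \<in> flow_polytope Q \<theta>" for x
    using norm_le_l1_cart[of x] sum_mono[of UNIV "\<lambda>a. \<bar>x $ a\<bar>"] bound[OF that]
    by (meson order_trans)
  then show ?thesis
    unfolding bounded_iff by blast
qed

lemma compact_flow_polytope:
  assumes "fin_digraph Q" "acyclic (arcs_ends Q)"
  shows "compact (flow_polytope Q \<theta>)"
  using bounded_flow_polytope[OF assms] closed_flow_polytope by (simp add: compact_eq_bounded_closed)

section \<open>Semistability and flows supported in a subquiver\<close>

text \<open>Zero coordinates do not decrease along \<open>d\<close>, and the finitely many positive
  ones stay positive for small steps. The filter \<open>at_right 0\<close> combines these conditions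
  without an explicit minimum.\<close>

lemma exists_feasible_step:
  fixes x d :: "real ^ 'e"
  assumes "\<And>a. x $ a \<ge> 0" "\<And>a. x $ a = 0 \<Longrightarrow> d $ a \<ge> 0"
  obtains \<epsilon> where "\<epsilon> > 0" "\<And>a. (x + \<epsilon> *\<^sub>R d) $ a \<ge> 0"
proof -
  have "\<forall>\<^sub>F \<epsilon> in at_right 0. x $ a + \<epsilon> * d $ a \<ge> 0" for a
  proof (cases "x $ a = 0")
    case True
    then show ?thesis
      using assms(2)[OF True] by (auto intro: eventually_mono[OF eventually_at_right_less])
  next
    case False
    have "((\<lambda>\<epsilon>. x $ a + \<epsilon> * d $ a) \<longlongrightarrow> x $ a + 0 * d $ a) (at_right 0)"
      by (intro tendsto_intros)
    moreover have "x $ a > 0"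
      using False assms(1)[of a] by simp
    ultimately have "\<forall>\<^sub>F \<epsilon> in at_right 0. x $ a + \<epsilon> * d $ a > 0"
      by (auto intro: order_tendstoD)
    then show ?thesis
      by (rule eventually_mono) simp
  qed
  then have "\<forall>\<^sub>F \<epsilon> in at_right 0. \<epsilon> > 0 \<and> (\<forall>a. x $ a + \<epsilon> * d $ a \<ge> 0)"
    by (intro eventually_conj eventually_at_right_less eventually_all_finite)
  then obtain \<epsilon> :: real where "\<epsilon> > 0 \<and> (\<forall>a. x $ a + \<epsilon> * d $ a \<ge> 0)"
    using eventually_happens'[OF trivial_limit_at_right_real] by blast
  then show ?thesis
    by (intro that[of \<epsilon>]) auto
qed

text \<open>No arrow of \<open>A\<close> leaves a successor closed \<open>V\<close>, so
  \<open>x\<close> carries nothing out of \<open>V\<close>, and its net inflow, the weight of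
  \<open>V\<close>, is nonnegative.\<close>

lemma semistable_if_supported_flow:
  assumes "fin_digraph Q" "A \<subseteq> arcs Q"
    and x: "x \<in> flow_polytope Q \<theta>" "\<And>a. a \<notin> A \<Longrightarrow> x $ a = 0"
  shows "semistable \<theta> (Q\<lparr>arcs := A\<rparr>)"
  unfolding semistable_def
proof (intro allI impI)
  interpret fin_digraph Q by fact
  fix V
  assume V: "V \<noteq> {} \<and> V \<subset> verts (Q\<lparr>arcs := A\<rparr>) \<and> successor_closed (Q\<lparr>arcs := A\<rparr>) V"
  then have fin: "finite V"
    by (auto intro: finite_subset[OF _ finite_verts])
  have "0 \<le> (\<Sum>a\<in>arcs Q. (of_bool (head Q a \<in> V) - of_bool (tail Q a \<in> V)) * x $ a)"
  proof (rule sum_nonneg)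
    fix a
    show "0 \<le> (of_bool (head Q a \<in> V) - of_bool (tail Q a \<in> V)) * x $ a"
      using V x(2)[of a] flow_polytopeD(1)[OF x(1), of a]
      by (cases "a \<in> A") (auto simp: successor_closed_def)
  qed
  also have "\<dots> = (\<Sum>i\<in>V. \<theta> i)"
    using V flow_polytopeD(3)[OF x(1)] by (subst sum_inc[OF fin, symmetric]) (auto intro!: sum.cong)
  finally show "0 \<le> (\<Sum>i\<in>V. \<theta> i)" .
qed

text \<open>A max-flow min-cut argument: compactness provides a flow with least total outside
  \<open>A\<close>, and the cut in its residual quiver would violate semistability if that total
  were positive.\<close>

lemma supported_flow_if_semistable:
  fixes Q :: "('v, 'e::finite) pre_digraph"
  assumes "fin_digraph Q" "A \<subseteq> arcs Q" "semistable \<theta> (Q\<lparr>arcs := A\<rparr>)"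
    and compact: "compact (flow_polytope Q \<theta>)" and ne: "flow_polytope Q \<theta> \<noteq> {}"
  obtains x where "x \<in> flow_polytope Q \<theta>" "\<And>a. a \<notin> A \<Longrightarrow> x $ a = 0"
proof -
  interpret fin_digraph Q by fact
  have "continuous_on (flow_polytope Q \<theta>) (\<lambda>x. \<Sum>a\<in>-A. x $ a)"
    by (intro continuous_intros)
  from continuous_attains_inf[OF compact ne this] obtain x
    where x: "x \<in> flow_polytope Q \<theta>"
      and least: "\<And>y. y \<in> flow_polytope Q \<theta> \<Longrightarrow> (\<Sum>a\<in>-A. x $ a) \<le> (\<Sum>a\<in>-A. y $ a)"
    by blast
  have "x $ a0 = 0" if a0: "a0 \<notin> A" for a0
  proof (rule ccontr)
    assume "x $ a0 \<noteq> 0"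
    then have pos: "x $ a0 > 0" and a0Q: "a0 \<in> arcs Q"
      using flow_polytopeD(1,2)[OF x, of a0] by auto
    \<comment> \<open>Residual moves: flow may be raised on arrows of \<open>A\<close> and lowered
      where it is positive. Raising it outside \<open>A\<close> is excluded, as that would increase
      the total being minimised.\<close>
    define R where "R = (\<lambda>a. (tail Q a, head Q a)) ` A
      \<union> (\<lambda>a. (head Q a, tail Q a)) ` {a \<in> arcs Q. x $ a > 0}"
    define V where "V = {v \<in> verts Q. (tail Q a0, v) \<in> R\<^sup>*}"
    have V: "finite V" "V \<subseteq> verts Q" "tail Q a0 \<in> V"
      using a0Q by (auto simp: V_def)
    have closed: "head Q a \<in> V" if "a \<in> A" "tail Q a \<in> V" for a
      using that assms(2) unfolding V_def R_def by (auto intro: rtrancl_into_rtrancl)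
    have closed_back: "tail Q a \<in> V" if "a \<in> arcs Q" "head Q a \<in> V" "x $ a > 0" for a
      using that assms(2) unfolding V_def R_def by (auto intro: rtrancl_into_rtrancl)
    \<comment> \<open>A residual path gives a unit flow \<open>d\<close> from
      \<open>tail Q a0\<close> to \<open>v\<close>. The sign conditions say that a small step along
      \<open>d\<close> is feasible and does not increase the total outside \<open>A\<close>. They
      survive each step of the path, which adds 1 only on \<open>A\<close> or subtracts 1 only where
      \<open>x\<close> is positive.\<close>
    have reroute: "\<exists>d::real ^ 'e. (\<forall>a. a \<notin> arcs Q \<longrightarrow> d $ a = 0)
        \<and> (\<forall>a. x $ a = 0 \<longrightarrow> d $ a \<ge> 0) \<and> (\<forall>a. a \<notin> A \<longrightarrow> d $ a \<le> 0)
        \<and> (\<forall>i. inc Q d i = of_bool (v = i) - of_bool (tail Q a0 = i))"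
      if "(tail Q a0, v) \<in> R\<^sup>*" for v
      using that
    proof (induction rule: rtrancl_induct)
      case base
      show ?case
        by (intro exI[of _ 0]) (simp add: inc_def)
    next
      case (step u v)
      from step.IH obtain d :: "real ^ 'e" where d: "\<And>a. a \<notin> arcs Q \<Longrightarrow> d $ a = 0"
        "\<And>a. x $ a = 0 \<Longrightarrow> d $ a \<ge> 0" "\<And>a. a \<notin> A \<Longrightarrow> d $ a \<le> 0"
        "\<And>i. inc Q d i = of_bool (u = i) - of_bool (tail Q a0 = i)"
        by blast
      from step.hyps(2) consider (extend) a where "a \<in> A" "u = tail Q a" "v = head Q a"
        | (reduce) a where "a \<in> arcs Q" "x $ a > 0" "u = head Q a" "v = tail Q a"
        unfolding R_def by blast
      then show ?case
      proof cases
        case extend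
        then have "a \<in> arcs Q"
          using assms(2) by auto
        with extend d show ?thesis
          by (intro exI[of _ "d + axis a 1"]) (auto simp: inc_add inc_axis axis_nth)
      next
        case reduce
        have "d $ a \<le> 1" if "a \<notin> A"
          using d(3)[OF that] by simp
        with reduce d show ?thesis
          by (intro exI[of _ "d - axis a 1"]) (auto simp: inc_diff inc_axis axis_nth)
      qed
    qed
    \<comment> \<open>Otherwise lowering \<open>a0\<close> and sending the same amount along a
      residual path from its tail to its head keeps \<open>inc\<close> unchanged, contradicting
      minimality of \<open>x\<close>.\<close>
    have head: "head Q a0 \<notin> V"
    proof
      assume "head Q a0 \<in> V"
      then have "(tail Q a0, head Q a0) \<in> R\<^sup>*"
        by (simp add: V_def)
      from reroute[OF this] obtain d :: "real ^ 'e" where d: "\<And>a. a \<notin> arcs Q \<Longrightarrow> d $ a = 0"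
        "\<And>a. x $ a = 0 \<Longrightarrow> d $ a \<ge> 0" "\<And>a. a \<notin> A \<Longrightarrow> d $ a \<le> 0"
        "\<And>i. inc Q d i = of_bool (head Q a0 = i) - of_bool (tail Q a0 = i)"
        by blast
      define d' where "d' = d - axis a0 1"
      have "d' $ a \<ge> 0" if "x $ a = 0" for a
        using d(2)[OF that] that pos by (auto simp: d'_def axis_nth)
      then obtain \<epsilon> where \<epsilon>: "\<epsilon> > 0" "\<And>a. (x + \<epsilon> *\<^sub>R d') $ a \<ge> 0"
        using exists_feasible_step[of x d'] flow_polytopeD(1)[OF x] by blast
      have "x + \<epsilon> *\<^sub>R d' \<in> flow_polytope Q \<theta>"
      proof (rule flow_polytopeI)
        fix a assume "a \<notin> arcs Q"
        then show "(x + \<epsilon> *\<^sub>R d') $ a = 0"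
          using a0Q d(1) flow_polytopeD(2)[OF x] by (auto simp: d'_def axis_nth)
      next
        fix i assume "i \<in> verts Q"
        then show "inc Q (x + \<epsilon> *\<^sub>R d') i = \<theta> i"
          using a0Q d(4) flow_polytopeD(3)[OF x]
          by (simp add: d'_def inc_add inc_scaleR inc_diff inc_axis)
      qed (rule \<epsilon>(2))
      from least[OF this] have "0 \<le> \<epsilon> * (\<Sum>a\<in>-A. d' $ a)"
        by (simp add: sum.distrib sum_distrib_left)
      then have "0 \<le> (\<Sum>a\<in>-A. d' $ a)"
        using \<epsilon>(1) by (simp add: zero_le_mult_iff)
      \<comment> \<open>Strictness comes from \<open>a0\<close>, where \<open>d'\<close> is at most
        -1.\<close>
      moreover have "(\<Sum>a\<in>-A. d' $ a) < (\<Sum>a\<in>-A. 0)"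
        using a0 d(3) by (intro sum_strict_mono_ex1) (force simp: d'_def axis_nth)+
      ultimately show False
        by simp
    qed
    \<comment> \<open>By \<open>closed_back\<close> no positive flow enters \<open>V\<close>, while
      \<open>a0\<close> carries positive flow out of it, so the net inflow is negative.\<close>
    have "(\<Sum>i\<in>V. \<theta> i) = (\<Sum>a\<in>arcs Q. (of_bool (head Q a \<in> V) - of_bool (tail Q a \<in> V)) * x $ a)"
      using V flow_polytopeD(3)[OF x] by (subst sum_inc[OF V(1), symmetric]) (auto intro!: sum.cong)
    also have "\<dots> < (\<Sum>a\<in>arcs Q. 0)"
    proof (rule sum_strict_mono_ex1)
      show "\<forall>a\<in>arcs Q. (of_bool (head Q a \<in> V) - of_bool (tail Q a \<in> V)) * x $ a \<le> 0"
        using closed_back flow_polytopeD(1)[OF x] by (force simp: of_bool_def less_le)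
      show "\<exists>a\<in>arcs Q. (of_bool (head Q a \<in> V) - of_bool (tail Q a \<in> V)) * x $ a < 0"
        using a0Q head V pos by (intro bexI[of _ a0]) auto
    qed simp
    finally have neg: "(\<Sum>i\<in>V. \<theta> i) < 0"
      by simp
    have "V \<noteq> {} \<and> V \<subset> verts (Q\<lparr>arcs := A\<rparr>) \<and> successor_closed (Q\<lparr>arcs := A\<rparr>) V"
      using V head closed a0Q by (auto simp: successor_closed_def)
    then have "(\<Sum>i\<in>V. \<theta> i) \<ge> 0"
      by (rule assms(3)[unfolded semistable_def, THEN spec, THEN mp])
    with neg show False
      by simp
  qed
  with x show ?thesis
    using that by blast
qed

section \<open>Rays contained in normal cones\<close>

lemma ev_in_ray: "ev Q a \<in> ray Q a"
  unfolding ray_def by (intro CollectI exI[of _ 1]) (simp add: ev_def cong: restrict_cong)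

lemma ker_inc_add: "x \<in> ker_inc Q \<Longrightarrow> y \<in> ker_inc Q \<Longrightarrow> x + y \<in> ker_inc Q"
  by (simp add: ker_inc_def arrow_space_def inc_add)

lemma ker_inc_scaleR: "x \<in> ker_inc Q \<Longrightarrow> c *\<^sub>R x \<in> ker_inc Q"
  by (simp add: ker_inc_def arrow_space_def inc_scaleR)

text \<open>Coordinates are nonnegative on the polytope, so one that vanishes on \<open>F\<close>
  attains its minimum there, as do its nonnegative multiples.\<close>

lemma ray_subset_normal_cone:
  assumes "F \<subseteq> flow_polytope Q \<theta>" "\<And>x. x \<in> F \<Longrightarrow> x $ a = 0"
  shows "ray Q a \<subseteq> normal_cone (ker_inc Q) (flow_polytope Q \<theta>) F"
proof
  fix \<phi> assume "\<phi> \<in> ray Q a"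
  then obtain c where c: "c \<ge> 0" and \<phi>: "\<phi> = restrict (\<lambda>x. c * x $ a) (ker_inc Q)"
    unfolding ray_def ev_def by (auto cong: restrict_cong)
  have "\<phi> \<in> dual_space (ker_inc Q)"
    by (simp add: \<phi> dual_space_def ker_inc_add ker_inc_scaleR algebra_simps)
  moreover have "\<phi> (y - x) \<ge> 0" if "x \<in> F" "y \<in> flow_polytope Q \<theta>" for x y
    using that c assms flow_polytope_diff_in_ker_inc[of x Q \<theta> y] flow_polytopeD(1)[OF that(2), of a]
    by (auto simp: \<phi>)
  ultimately show "\<phi> \<in> normal_cone (ker_inc Q) (flow_polytope Q \<theta>) F"
    by (simp add: normal_cone_def)
qed

text \<open>Testing the cone on the generator \<open>ev Q a\<close> makes every point of
  \<open>F\<close> a minimiser of the coordinate \<open>a\<close>. Once that minimum is known to be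
  0, this is the converse of \<open>ray_subset_normal_cone\<close>.\<close>

lemma coordinate_le_if_ray_subset_normal_cone:
  assumes "ray Q a \<subseteq> normal_cone (ker_inc Q) (flow_polytope Q \<theta>) F"
    and "F \<subseteq> flow_polytope Q \<theta>" "x \<in> F" "y \<in> flow_polytope Q \<theta>"
  shows "x $ a \<le> y $ a"
proof -
  have "ev Q a (y - x) \<ge> 0"
    using assms ev_in_ray[of Q a] by (auto simp: normal_cone_def)
  moreover have "y - x \<in> ker_inc Q"
    using assms by (intro flow_polytope_diff_in_ker_inc) auto
  ultimately show ?thesis
    by (simp add: ev_def)
qed

section \<open>Extreme points and supports\<close>

text \<open>If \<open>x\<close> differed from \<open>v\<close>, the segment from \<open>x\<close> to
  \<open>v\<close> could be prolonged beyond \<open>v\<close>: the direction \<open>v - x\<close>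
  vanishes wherever \<open>v\<close> does. Then \<open>v\<close> would not be extreme.\<close>

lemma extreme_flow_unique:
  assumes "v extreme_point_of flow_polytope Q \<theta>" "x \<in> flow_polytope Q \<theta>"
    and supp: "\<And>a. v $ a = 0 \<Longrightarrow> x $ a = 0"
  shows "x = v"
proof (rule ccontr)
  assume "x \<noteq> v"
  have v: "v \<in> flow_polytope Q \<theta>"
    using assms(1) by (simp add: extreme_point_of_def)
  obtain \<epsilon> where \<epsilon>: "\<epsilon> > 0" "\<And>a. (v + \<epsilon> *\<^sub>R (v - x)) $ a \<ge> 0"
    using exists_feasible_step[of v "v - x"] flow_polytopeD(1)[OF v] supp by auto
  define y where "y = v + \<epsilon> *\<^sub>R (v - x)"
  have "y \<in> flow_polytope Q \<theta>"
    using \<epsilon>(2) flow_polytopeD[OF v] flow_polytopeD[OF assms(2)]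
    by (intro flow_polytopeI) (auto simp: y_def inc_add inc_scaleR inc_diff)
  moreover have "v \<in> open_segment x y"
  proof -
    \<comment> \<open>Solving \<open>y = (1 + \<epsilon>) v - \<epsilon> x\<close> for
      \<open>v\<close> gives these weights.\<close>
    have "v = (1 - 1 / (1 + \<epsilon>)) *\<^sub>R x + (1 / (1 + \<epsilon>)) *\<^sub>R y"
    proof -
      have "(1 + \<epsilon>) *\<^sub>R v = \<epsilon> *\<^sub>R x + y"
        by (simp add: y_def algebra_simps)
      then have "v = (1 / (1 + \<epsilon>)) *\<^sub>R (\<epsilon> *\<^sub>R x + y)"
        using \<epsilon>(1) by (metis add_pos_pos divide_self_if less_irrefl scaleR_one scaleR_scaleR
            times_divide_eq_left mult_1 zero_less_one)
      moreover have "\<epsilon> / (1 + \<epsilon>) = 1 - 1 / (1 + \<epsilon>)"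
        using \<epsilon>(1) by (simp add: field_simps)
      ultimately show ?thesis
        by (simp add: scaleR_right_distrib)
    qed
    moreover have "x \<noteq> y"
    proof
      assume "x = y"
      then have "(1 + \<epsilon>) *\<^sub>R (v - x) = 0"
        by (simp add: y_def algebra_simps)
      then show False
        using \<epsilon>(1) \<open>x \<noteq> v\<close> by simp
    qed
    ultimately show ?thesis
      using \<epsilon>(1) unfolding in_segment by (intro conjI exI[of _ "1 / (1 + \<epsilon>)"]) (auto simp: field_simps)
  qed
  ultimately show False
    using assms(1,2) by (auto simp: extreme_point_of_def)
qed

text \<open>The flows supported in \<open>A\<close> form a face, cut out by the vanishing of the
  nonnegative total outside \<open>A\<close>. Extreme points of a face are extreme in the
  polytope.\<close>

lemma exists_extreme_flow_supported:
  fixes Q :: "('v, 'e::finite) pre_digraph"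
  assumes "compact (flow_polytope Q \<theta>)"
    and x: "x \<in> flow_polytope Q \<theta>" "\<And>a. a \<notin> A \<Longrightarrow> x $ a = 0"
  obtains v where "v extreme_point_of flow_polytope Q \<theta>" "\<And>a. a \<notin> A \<Longrightarrow> v $ a = 0"
proof -
  let ?P = "flow_polytope Q \<theta>"
  \<comment> \<open>The total is written as an inner product so that \<open>F\<close> is visibly cut
    out by a supporting hyperplane.\<close>
  define F where "F = ?P \<inter> {y. (\<Sum>a\<in>-A. axis a 1) \<bullet> y = 0}"
  have total: "(\<Sum>a\<in>-A. axis a 1) \<bullet> y = (\<Sum>a\<in>-A. y $ a)" for y :: "real ^ 'e"
    by (simp add: inner_sum_left inner_axis')
  have face: "F face_of ?P"
    unfolding F_def using flow_polytopeD(1)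
    by (intro face_of_Int_supporting_hyperplane_ge convex_flow_polytope) (auto simp: total intro!: sum_nonneg)
  have "compact F" "convex F"
    using face assms(1) by (auto intro: face_of_imp_compact face_of_imp_convex convex_flow_polytope)
  moreover have "x \<in> F"
    using x by (simp add: F_def total)
  ultimately obtain v where "v extreme_point_of F"
    using extreme_point_exists_convex by blast
  then have v: "v extreme_point_of ?P" "v \<in> F"
    using extreme_point_of_face[OF face] by auto
  then have "v $ a = 0" if "a \<notin> A" for a
    using that flow_polytopeD(1)[of v Q \<theta>] by (auto simp: F_def total sum_nonneg_eq_0_iff)
  with v(1) show ?thesis
    by (rule that)
qed

section \<open>Comparison of the two zero loci\<close>

theorem theorem3p9:
  fixes Q :: "('v, 'e::finite) pre_digraph"
  assumes "fin_digraph Q"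
    and "Digraph_Component.connected Q"
    and "acyclic (arcs_ends Q)"
    and "generic Q (canonical_weight Q)"
    and "tight Q (canonical_weight Q)"
  shows "Z_chi Q (canonical_weight Q) = Z_Cox Q (flow_fan Q (canonical_weight Q))"
proof -
  define \<theta> where "\<theta> = canonical_weight Q"
  define P where "P = flow_polytope Q \<theta>"
  define N where "N = normal_cone (ker_inc Q) P"
  have compact: "compact P"
    unfolding P_def using assms by (intro compact_flow_polytope)
  have "(\<chi> a. indicat_real (arcs Q) a) \<in> P"
    unfolding P_def by (rule flow_polytopeI) (auto simp: \<theta>_def canonical_weight_def)
  then have ne: "P \<noteq> {}"
    by blast
  have semistable_iff: "semistable \<theta> (Q\<lparr>arcs := A\<rparr>) \<longleftrightarrow> (\<exists>x\<in>P. \<forall>a. a \<notin> A \<longrightarrow> x $ a = 0)"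
    if "A \<subseteq> arcs Q" for A
    using semistable_if_supported_flow[OF assms(1) that]
      supported_flow_if_semistable[OF assms(1) that] compact ne unfolding P_def by metis
  \<comment> \<open>Tightness keeps the quiver semistable without \<open>a\<close>, so some flow
    avoids \<open>a\<close>; for \<open>a\<close> off \<open>arcs Q\<close> every flow does.\<close>
  have vanishing: "\<exists>y\<in>P. y $ a = 0" for a
  proof (cases "a \<in> arcs Q")
    case True
    then have "semistable \<theta> (Q\<lparr>arcs := arcs Q - {a}\<rparr>)"
      using assms(5) unfolding tight_def stable_def semistable_def \<theta>_def by (meson less_imp_le)
    then show ?thesis
      by (subst (asm) semistable_iff) auto
  next
    case False
    then show ?thesis
      using ne flow_polytopeD(2) unfolding P_def by blast
  qed
  have ray_zero: "x $ a = 0" if "ray Q a \<subseteq> N F" "F \<subseteq> P" "x \<in> F" for x a F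
  proof -
    obtain y where "y \<in> P" "y $ a = 0"
      using vanishing by blast
    then have "x $ a \<le> 0"
      using coordinate_le_if_ray_subset_normal_cone[of Q a \<theta> F x y] that by (simp add: N_def P_def)
    then show ?thesis
      using flow_polytopeD(1)[of x Q \<theta> a] that by (auto simp: P_def)
  qed
  \<comment> \<open>If \<open>N {v}\<close> lies in \<open>N G\<close>, every coordinate vanishing
    at \<open>v\<close> has its ray in \<open>N G\<close> and so vanishes on \<open>G\<close>. By
    \<open>extreme_flow_unique\<close> the face \<open>G\<close> is then \<open>{v}\<close>; no
    dimension count for cones enters.\<close>
  have maximal: "N {v} \<in> maximal_cones (flow_fan Q \<theta>)" if v: "v extreme_point_of P" for v
  proof -
    have vP: "v \<in> P"
      using v by (simp add: extreme_point_of_def)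
    have "N G = N {v}" if G: "G face_of P" "G \<noteq> {}" and sub: "N {v} \<subseteq> N G" for G
    proof -
      have "x = v" if "x \<in> G" for x
      proof (rule extreme_flow_unique)
        show "v extreme_point_of flow_polytope Q \<theta>" "x \<in> flow_polytope Q \<theta>"
          using v face_of_imp_subset[OF G(1)] that by (auto simp: P_def)
        fix a assume "v $ a = 0"
        then have "ray Q a \<subseteq> N {v}"
          using vP unfolding N_def P_def by (intro ray_subset_normal_cone) auto
        then show "x $ a = 0"
          using ray_zero[of a G x] sub face_of_imp_subset[OF G(1)] that by blast
      qed
      with G(2) have "G = {v}"
        by blast
      then show ?thesis
        by simp
    qed
    moreover have "{v} face_of P"
      using v by (simp add: face_of_singleton)
    ultimately show ?thesis
      unfolding maximal_cones_def flow_fan_def normal_fan_def N_def P_def by blast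
  qed
  \<comment> \<open>Both sides describe the complements of the loci at \<open>w\<close>. The product
    is nonzero iff \<open>\<sigma>\<close> contains the ray of every arrow on which \<open>w\<close>
    vanishes.\<close>
  have "semistable \<theta> (Q\<lparr>arcs := A\<rparr>) \<longleftrightarrow>
      (\<exists>\<sigma> \<in> maximal_cones (flow_fan Q \<theta>). (\<Prod>a | a \<in> arcs Q \<and> \<not> ray Q a \<subseteq> \<sigma>. w $ a) \<noteq> 0)"
    (is "?L \<longleftrightarrow> ?R") if A: "A = {a \<in> arcs Q. w $ a \<noteq> 0}" for A and w :: "complex ^ 'e"
  proof
    assume ?L
    then obtain x where "x \<in> P" "\<And>a. a \<notin> A \<Longrightarrow> x $ a = 0"
      using semistable_iff[of A] A by blast
    then obtain v where v: "v extreme_point_of P" "\<And>a. a \<notin> A \<Longrightarrow> v $ a = 0"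
      using exists_extreme_flow_supported[of Q \<theta> x A] compact unfolding P_def by blast
    have "w $ a \<noteq> 0" if "a \<in> arcs Q" "\<not> ray Q a \<subseteq> N {v}" for a
    proof
      assume "w $ a = 0"
      then have "ray Q a \<subseteq> N {v}"
        using v A unfolding N_def P_def
        by (intro ray_subset_normal_cone) (auto simp: extreme_point_of_def)
      with that show False
        by blast
    qed
    with maximal[OF v(1)] show ?R
      by (intro bexI[of _ "N {v}"]) auto
  next
    assume ?R
    then obtain F where F: "F face_of P" "F \<noteq> {}"
      and prod: "(\<Prod>a | a \<in> arcs Q \<and> \<not> ray Q a \<subseteq> N F. w $ a) \<noteq> 0"
      unfolding maximal_cones_def flow_fan_def normal_fan_def N_def P_def by blast
    from F obtain x where x: "x \<in> F" "F \<subseteq> P"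
      using face_of_imp_subset by blast
    \<comment> \<open>An arrow outside \<open>A\<close> has \<open>w $ a = 0\<close>, so its ray
      must lie in \<open>N F\<close>, or else it would contribute a zero factor; then
      \<open>ray_zero\<close> applies.\<close>
    have "x $ a = 0" if "a \<notin> A" for a
      using that A prod ray_zero[OF _ x(2,1)] flow_polytopeD(2)[of x Q \<theta>] x
      by (cases "a \<in> arcs Q") (auto simp: P_def)
    with x show ?L
      using semistable_iff[of A] A by blast
  qed
  from this[OF refl] show ?thesis
    unfolding Z_chi_def Z_Cox_def unstable_def \<theta>_def[symmetric] by (simp only: bex_simps not_not)
qed

end
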